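(* Let $f:\mathbb{R}^n\to\mathbb{R}$ be $\nu$-smooth and $\mu$-strongly convex with $\inf_z f(z)=0$, let $X\in\mathbb{R}^{n\times p}$, and let $\Omega:\mathbb{R}^p\to\mathbb{R}\cup\{+\infty\}$ be proper, closed and convex. Let $\lambda>0$ be a target parameter, $\lambda_0>\lambda$, $T\ge1$ an integer, and $r\in(0,\frac{\mu}{\nu})$. Let $\beta_0,\dots,\beta_T\in\operatorname{dom}\Omega$ with associated rescaled dual feasible vectors $\theta_t=-\nabla f(X\beta_t)/\alpha_t$, $\alpha_t\ge\lambda_t$, let $\epsilon_0,\dots,\epsilon_{T-1}\ge0$, and suppose $\zeta_t\ne0$ for $t=0,\dots,T-1$. Suppose that for every $t\in\{0,\dots,T-1\}$ the following hold: (i) $f(X\beta_{t+1})\le f(X\beta_t)$; (ii) $D_t(\epsilon_t)\ge0$, where $$D_t(\epsilon):=\left(\frac{\lambda_t\,\mu}{\alpha_t\,\nu}\right)^2\left[\left(1-r\frac{\nu}{\mu}\right)\left(1-\frac{\lambda}{\lambda_t}\right)^2-\frac{2\nu\,\epsilon}{\|\zeta_t\|^2}\right];$$ (iii) the parameters are defined sequentially by $\lambda_{t+1}=\dfrac{\lambda}{1-\sqrt{D_t(\epsilon_t)}}$; (iv) $\mathcal{E}_{t+1}\le(1-r)\,\mathcal{E}_t+\epsilon_t$. Then $$\mathrm{Gap}_\lambda(\beta_T,\theta_T)\le(1-r)^T\,\mathrm{Gap}_\lambda(\beta_0,\theta_0).$$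
   Context: Norms on $\mathbb{R}^n$ are Euclidean. A differentiable function $f$ is $\nu$-smooth and $\mu$-strongly convex ($0<\mu\le\nu$) if for all $z,z_0$: $\frac{\mu}{2}\|z-z_0\|^2\le f(z)-f(z_0)-\langle\nabla f(z_0),z-z_0\rangle\le\frac{\nu}{2}\|z-z_0\|^2$. The Fenchel conjugate is $g^*(u)=\sup_{x}\langle u,x\rangle-g(x)$. For $\gamma>0$: primal objective $P_\gamma(\beta)=f(X\beta)+\gamma\,\Omega(\beta)$; dual objective $-f^*(-\gamma\theta)-\gamma\,\Omega^*(X^\top\theta)$; duality gap $\mathrm{Gap}_\gamma(\beta,\theta)=f(X\beta)+\gamma\,\Omega(\beta)+f^*(-\gamma\theta)+\gamma\,\Omega^*(X^\top\theta)$. For each index $t$, with regularization parameter $\lambda_t>0$ and primal vector $\beta_t$, the dual vector is $\theta_t=-\nabla f(X\beta_t)/\alpha_t$, where $\alpha_t\ge\lambda_t$ is a scalar making $\theta_t$ dual feasible, i.e. $\Omega^*(X^\top\theta_t)<+\infty$ (for $\Omega=\|\cdot\|_1$ one takes $\alpha_t=\max(\lambda_t,\|X^\top\nabla f(X\beta_t)\|_\infty)$). Further notation, for the fixed target parameter $\lambda$: $\zeta_t=-\lambda_t\theta_t$; $\mathrm{Gap}_t=\mathrm{Gap}_{\lambda_t}(\beta_t,\theta_t)$; $\Delta_t=f(X\beta_t)-f(\nabla f^*(\zeta_t))$; $\mathcal{E}_t=\mathcal{E}_t(\lambda)=\frac{\lambda}{\lambda_t}\mathrm{Gap}_t+\left(1-\frac{\lambda}{\lambda_t}\right)\Delta_t$.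 *)

theory Defs
  imports "HOL-Analysis.Analysis"
begin

text \<open>Extended-real-valued convex analysis. Convexity and closedness are read off the epigraph,
  since \<^const>\<open>convex_on\<close> only covers real-valued functions.\<close>

definition ereal_epigraph :: "('a \<Rightarrow> ereal) \<Rightarrow> ('a \<times> real) set" where
  "ereal_epigraph g = {(x, a). g x \<le> ereal a}"

definition effective_domain :: "('a \<Rightarrow> ereal) \<Rightarrow> 'a set" where
  "effective_domain g = {x. g x < \<infinity>}"

definition proper_fun :: "('a \<Rightarrow> ereal) \<Rightarrow> bool" where
  "proper_fun g \<longleftrightarrow> (\<forall>x. g x \<noteq> -\<infinity>) \<and> effective_domain g \<noteq> {}"

definition closed_fun :: "('a::topological_space \<Rightarrow> ereal) \<Rightarrow> bool" where
  "closed_fun g \<longleftrightarrow> closed (ereal_epigraph g)"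

definition convex_fun :: "('a::real_vector \<Rightarrow> ereal) \<Rightarrow> bool" where
  "convex_fun g \<longleftrightarrow> convex (ereal_epigraph g)"

definition fenchel_conj :: "('a::real_inner \<Rightarrow> ereal) \<Rightarrow> 'a \<Rightarrow> ereal" where
  "fenchel_conj g u = (SUP x. ereal (u \<bullet> x) - g x)"

abbreviation fenchel_conj_real :: "('a::real_inner \<Rightarrow> real) \<Rightarrow> 'a \<Rightarrow> ereal" where
  "fenchel_conj_real f \<equiv> fenchel_conj (\<lambda>z. ereal (f z))"

text \<open>The gradient is unspecified at points where the function is not differentiable.\<close>

definition grad :: "('a::real_inner \<Rightarrow> real) \<Rightarrow> 'a \<Rightarrow> 'a" where
  "grad f z = (THE d. GDERIV f z :> d)"

text \<open>The conjugate of a strongly convex function is finite everywhere, so converting it to a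
  real-valued function before taking the gradient loses nothing.\<close>

definition grad_conj :: "('a::real_inner \<Rightarrow> real) \<Rightarrow> 'a \<Rightarrow> 'a" where
  "grad_conj f = grad (\<lambda>u. real_of_ereal (fenchel_conj_real f u))"

definition smooth_strongly_convex :: "real \<Rightarrow> real \<Rightarrow> ('a::real_inner \<Rightarrow> real) \<Rightarrow> bool" where
  "smooth_strongly_convex \<nu> \<mu> f \<longleftrightarrow>
     (\<forall>z. f differentiable (at z)) \<and>
     (\<forall>z z0. \<mu> / 2 * (norm (z - z0))\<^sup>2 \<le> f z - f z0 - grad f z0 \<bullet> (z - z0) \<and>
             f z - f z0 - grad f z0 \<bullet> (z - z0) \<le> \<nu> / 2 * (norm (z - z0))\<^sup>2)"

text \<open>The gap is extended-real-valued. For proper \<open>\<Omega>\<close> and \<open>\<gamma> > 0\<close>, none of its four summands is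
  \<open>-\<infinity>\<close>, so the value \<open>\<infinity> + -\<infinity>\<close> never arises in it.\<close>

definition duality_gap ::
  "(real ^ 'n \<Rightarrow> real) \<Rightarrow> (real ^ 'p \<Rightarrow> ereal) \<Rightarrow> real ^ 'p ^ 'n \<Rightarrow>
     real \<Rightarrow> real ^ 'p \<Rightarrow> real ^ 'n \<Rightarrow> ereal" where
  "duality_gap f \<Omega> X \<gamma> \<beta> \<theta> =
     ereal (f (X *v \<beta>)) + ereal \<gamma> * \<Omega> \<beta> +
     fenchel_conj_real f (- \<gamma> *\<^sub>R \<theta>) + ereal \<gamma> * fenchel_conj \<Omega> (transpose X *v \<theta>)"

text \<open>In the following, \<open>lt\<close>, \<open>\<beta>\<close>, \<open>\<theta>\<close>, \<open>\<zeta>\<close> and \<open>\<alpha>\<close> stand for the values of the respective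
  sequences at one index, while \<open>l\<close> is the target parameter.\<close>

definition Delta_term ::
  "(real ^ 'n \<Rightarrow> real) \<Rightarrow> real ^ 'p ^ 'n \<Rightarrow> real ^ 'p \<Rightarrow> real ^ 'n \<Rightarrow> real" where
  "Delta_term f X \<beta> \<zeta> = f (X *v \<beta>) - f (grad_conj f \<zeta>)"

definition E_term ::
  "(real ^ 'n \<Rightarrow> real) \<Rightarrow> (real ^ 'p \<Rightarrow> ereal) \<Rightarrow> real ^ 'p ^ 'n \<Rightarrow>
     real \<Rightarrow> real \<Rightarrow> real ^ 'p \<Rightarrow> real ^ 'n \<Rightarrow> ereal" where
  "E_term f \<Omega> X l lt \<beta> \<theta> =
     ereal (l / lt) * duality_gap f \<Omega> X lt \<beta> \<theta> +
     ereal ((1 - l / lt) * Delta_term f X \<beta> (- lt *\<^sub>R \<theta>))"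

definition D_term ::
  "real \<Rightarrow> real \<Rightarrow> real \<Rightarrow> real \<Rightarrow> real \<Rightarrow> real \<Rightarrow> 'a::real_normed_vector \<Rightarrow> real \<Rightarrow> real" where
  "D_term \<nu> \<mu> r l lt \<alpha> \<zeta> \<epsilon> =
     ((lt * \<mu>) / (\<alpha> * \<nu>))\<^sup>2 *
     ((1 - r * (\<nu> / \<mu>)) * (1 - l / lt)\<^sup>2 - 2 * \<nu> * \<epsilon> / (norm \<zeta>)\<^sup>2)"

end

theory Submission
  imports Defs
begin

text \<open>Write \<open>\<rho> = 1 - l / lam t\<close>. Expanding the conjugate around \<open>\<zeta> t\<close> gives
  \<open>Gap l = E t + B t\<close>, where \<open>B t\<close> is the Bregman divergence of the conjugate between
  \<open>(1 - \<rho>) \<zeta>\<close> and \<open>\<zeta>\<close>. Since the conjugate is \<open>1/\<nu>\<close>-strongly convex and \<open>1/\<mu>\<close>-smooth, \<open>B t\<close> lies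
  between \<open>(\<rho> norm \<zeta>)\<^sup>2 / (2\<nu>)\<close> and \<open>(\<rho> norm \<zeta>)\<^sup>2 / (2\<mu>)\<close>. The step size rule makes \<open>\<rho>\<close> at \<open>t + 1\<close>
  equal to the square root of \<open>D t\<close>; as \<open>norm (grad f)\<^sup>2\<close> is comparable to \<open>f\<close>, which decreases along
  the iterates, \<open>D t\<close> is just small enough for \<open>B (t + 1) + \<epsilon> t \<le> (1 - r) B t\<close>. Hence the gap
  contracts by the factor \<open>1 - r\<close> at every step.\<close>

section \<open>Completing the square, and gradients from quadratic remainder bounds\<close>

lemma quadratic_lower_bound:
  fixes w h :: "'a::real_inner"
  assumes "0 < c"
  shows "- ((norm w)\<^sup>2 / (2 * c)) \<le> w \<bullet> h + c / 2 * (norm h)\<^sup>2"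
proof -
  \<comment> \<open>Expanded, this square is the difference of the two sides.\<close>
  have "0 \<le> (norm (w + c *\<^sub>R h))\<^sup>2 / (2 * c)"
    using assms by simp
  also have "(norm (w + c *\<^sub>R h))\<^sup>2 = (norm w)\<^sup>2 + 2 * c * (w \<bullet> h) + c\<^sup>2 * (norm h)\<^sup>2"
    unfolding power2_norm_eq_inner by (simp add: algebra_simps inner_commute power2_eq_square)
  finally show ?thesis
    using assms by (simp add: field_simps power2_eq_square)
qed

lemma quadratic_minimum:
  fixes w :: "'a::real_inner"
  assumes "0 < c"
  shows "w \<bullet> (- (1 / c) *\<^sub>R w) + c / 2 * (norm (- (1 / c) *\<^sub>R w))\<^sup>2 = - ((norm w)\<^sup>2 / (2 * c))"
  unfolding power2_norm_eq_inner using assms by (simp add: field_simps power2_eq_square)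

lemma gderiv_unique:
  assumes "GDERIV h z :> d" "GDERIV h z :> e"
  shows "d = e"
proof -
  have "(\<lambda>x. x \<bullet> d) = (\<lambda>x. x \<bullet> e)"
    using assms unfolding gderiv_def by (rule has_derivative_unique)
  then have "(d - e) \<bullet> (d - e) = 0"
    by (metis inner_diff_right right_minus_eq)
  then show ?thesis
    by simp
qed

text \<open>A quadratic remainder divided by \<open>norm (z - z0)\<close> still tends to 0, and
  uniqueness of the derivative makes \<open>THE\<close> pick \<open>d\<close>.\<close>

lemma grad_eqI:
  assumes "\<And>z. \<bar>h z - h z0 - d \<bullet> (z - z0)\<bar> \<le> C * (norm (z - z0))\<^sup>2"
  shows "grad h z0 = d"
proof -
  have lim: "((\<lambda>y. C * norm (y - z0)) \<longlongrightarrow> 0) (at z0)"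
    by (auto intro!: tendsto_eq_intros)
  have "(h has_derivative (\<lambda>x. x \<bullet> d)) (at z0)"
  proof (rule has_derivativeI_sandwich[of 1])
    show "bounded_linear (\<lambda>x. x \<bullet> d)"
      by (rule bounded_linear_inner_left)
    show "norm (h y - h z0 - (y - z0) \<bullet> d) / norm (y - z0) \<le> C * norm (y - z0)"
      if "y \<noteq> z0" for y
      using assms[of y] that by (simp add: field_simps power2_eq_square inner_commute)
  qed (use lim in auto)
  then have "GDERIV h z0 :> d"
    by (simp add: gderiv_def)
  then show ?thesis
    unfolding grad_def using gderiv_unique by blast
qed

section \<open>Gradient inequalities from smoothness and strong convexity\<close>

lemma strongly_convex_lower:
  assumes "smooth_strongly_convex \<nu> \<mu> f"
  shows "f z0 + grad f z0 \<bullet> (z - z0) + \<mu> / 2 * (norm (z - z0))\<^sup>2 \<le> f z"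
  using assms unfolding smooth_strongly_convex_def by (smt (verit))

lemma smooth_upper:
  assumes "smooth_strongly_convex \<nu> \<mu> f"
  shows "f z \<le> f z0 + grad f z0 \<bullet> (z - z0) + \<nu> / 2 * (norm (z - z0))\<^sup>2"
  using assms unfolding smooth_strongly_convex_def by (smt (verit))

text \<open>The witness minimizes the quadratic upper model at \<open>x\<close> of the tilted
  function \<open>f z - v \<bullet> z\<close>. Different tilts \<open>v\<close> give the gradient
  bound, the surjectivity of the gradient and the lower Bregman bound.\<close>

lemma gradient_step_descent:
  fixes f :: "'a::real_inner \<Rightarrow> real"
  assumes "smooth_strongly_convex \<nu> \<mu> f" "0 < \<nu>"
  shows "\<exists>z. f z - v \<bullet> z \<le> f x - v \<bullet> x - (norm (grad f x - v))\<^sup>2 / (2 * \<nu>)"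
proof
  let ?w = "grad f x - v"
  let ?h = "- (1 / \<nu>) *\<^sub>R ?w"
  have "f (x + ?h) \<le> f x + grad f x \<bullet> ?h + \<nu> / 2 * (norm ?h)\<^sup>2"
    using smooth_upper[OF assms(1), of "x + ?h" x] by simp
  then show "f (x + ?h) - v \<bullet> (x + ?h) \<le> f x - v \<bullet> x - (norm ?w)\<^sup>2 / (2 * \<nu>)"
    using quadratic_minimum[OF assms(2), of ?w]
    by (simp only: inner_add_right inner_diff_left)
qed

text \<open>The decrease guaranteed by a gradient step cannot exceed \<open>f x\<close>, as
  \<open>f\<close> stays nonnegative.\<close>

lemma norm_grad_le:
  fixes f :: "'a::real_inner \<Rightarrow> real"
  assumes "smooth_strongly_convex \<nu> \<mu> f" "0 < \<nu>" "\<And>z. 0 \<le> f z"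
  shows "(norm (grad f x))\<^sup>2 \<le> 2 * \<nu> * f x"
proof -
  obtain z where "f z \<le> f x - (norm (grad f x))\<^sup>2 / (2 * \<nu>)"
    using gradient_step_descent[OF assms(1,2), of 0 x] by auto
  with assms(3)[of z] have "(norm (grad f x))\<^sup>2 / (2 * \<nu>) \<le> f x"
    by linarith
  then show ?thesis
    using assms(2) by (simp add: field_simps)
qed

text \<open>Minimizing the strongly convex lower model at \<open>x\<close> over all points bounds
  the infimum of \<open>f\<close>, which is 0, from below.\<close>

lemma Polyak_Lojasiewicz:
  fixes f :: "'a::real_inner \<Rightarrow> real"
  assumes "smooth_strongly_convex \<nu> \<mu> f" "0 < \<mu>" "(INF z. ereal (f z)) = 0"
  shows "2 * \<mu> * f x \<le> (norm (grad f x))\<^sup>2"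
proof -
  have "ereal (f x - (norm (grad f x))\<^sup>2 / (2 * \<mu>)) \<le> (INF z. ereal (f z))"
  proof (rule INF_greatest)
    fix z
    show "ereal (f x - (norm (grad f x))\<^sup>2 / (2 * \<mu>)) \<le> ereal (f z)"
      using strongly_convex_lower[OF assms(1), of x z]
        quadratic_lower_bound[OF assms(2), of "grad f x" "z - x"] by simp
  qed
  then have "f x \<le> (norm (grad f x))\<^sup>2 / (2 * \<mu>)"
    using assms(3) by (simp add: zero_ereal_def)
  then show ?thesis
    using assms(2) by (simp add: field_simps)
qed

section \<open>The range of the gradient and the Fenchel conjugate\<close>

lemma smooth_continuous:
  assumes "smooth_strongly_convex \<nu> \<mu> f"
  shows "continuous_on S f"
proof -
  have "f differentiable (at z)" for z
    using assms by (simp add: smooth_strongly_convex_def)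
  then show ?thesis
    by (meson continuous_at_imp_continuous_on differentiable_imp_continuous_within)
qed

text \<open>A minimizer of \<open>f\<close> tilted by \<open>u\<close> has gradient
  \<open>u\<close>, since a gradient step from it cannot descend. Thus the conjugate can be
  evaluated at every dual vector.\<close>

lemma grad_surj:
  fixes f :: "'a::euclidean_space \<Rightarrow> real"
  assumes ssc: "smooth_strongly_convex \<nu> \<mu> f" and "0 < \<mu>" "0 < \<nu>"
  shows "\<exists>x. grad f x = u"
proof -
  define \<phi> where "\<phi> x = f x - u \<bullet> x" for x
  \<comment> \<open>\<open>w\<close> is the gradient of \<open>\<phi>\<close> at 0. Beyond radius
    \<open>R\<close> the growth \<open>\<mu> / 2 * (norm y)\<^sup>2\<close> outweighs the linear
    term \<open>w \<bullet> y\<close>.\<close>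
  define w where "w = grad f 0 - u"
  define R where "R = 2 * norm w / \<mu>"
  have "continuous_on (cball 0 R) \<phi>"
    unfolding \<phi>_def by (intro continuous_intros smooth_continuous[OF ssc])
  moreover have "0 \<le> R"
    using assms by (simp add: R_def)
  ultimately obtain x where x: "\<forall>y \<in> cball 0 R. \<phi> x \<le> \<phi> y"
    using continuous_attains_inf[of "cball 0 R" \<phi>] by auto
  have min: "\<phi> x \<le> \<phi> y" for y
  proof (cases "norm y \<le> R")
    case True
    then show ?thesis
      using x by simp
  next
    case False
    have "norm w \<le> \<mu> / 2 * norm y"
      using False assms by (simp add: R_def field_simps)
    then have "norm w * norm y \<le> \<mu> / 2 * norm y * norm y"
      by (rule mult_right_mono) simp
    moreover have "- (norm w * norm y) \<le> w \<bullet> y"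
      using Cauchy_Schwarz_ineq2[of w y] by linarith
    ultimately have "\<phi> 0 \<le> \<phi> y"
      using strongly_convex_lower[OF ssc, of 0 y]
      by (simp add: \<phi>_def w_def inner_diff_left power2_eq_square)
    moreover have "\<phi> x \<le> \<phi> 0"
      using x \<open>0 \<le> R\<close> by simp
    ultimately show ?thesis
      by linarith
  qed
  obtain z where "\<phi> z \<le> \<phi> x - (norm (grad f x - u))\<^sup>2 / (2 * \<nu>)"
    using gradient_step_descent[OF ssc assms(3), of u x] by (auto simp: \<phi>_def)
  with min[of z] have "(norm (grad f x - u))\<^sup>2 / (2 * \<nu>) \<le> 0"
    by linarith
  then have "grad f x = u"
    using assms(3) by (simp add: divide_le_0_iff)
  then show ?thesis ..
qed

text \<open>Equality case of Fenchel-Young: the tangent of \<open>f\<close> at \<open>x\<close> lies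
  below \<open>f\<close>, so the supremum is attained at \<open>x\<close>.\<close>

lemma fenchel_conj_grad:
  fixes f :: "'a::real_inner \<Rightarrow> real"
  assumes "smooth_strongly_convex \<nu> \<mu> f" "0 \<le> \<mu>"
  shows "fenchel_conj_real f (grad f x) = ereal (grad f x \<bullet> x - f x)"
  unfolding fenchel_conj_def
proof (rule antisym)
  show "(SUP z. ereal (grad f x \<bullet> z) - ereal (f z)) \<le> ereal (grad f x \<bullet> x - f x)"
  proof (rule SUP_least)
    fix z
    have "0 \<le> \<mu> / 2 * (norm (z - x))\<^sup>2"
      using assms(2) by simp
    then show "ereal (grad f x \<bullet> z) - ereal (f z) \<le> ereal (grad f x \<bullet> x - f x)"
      using strongly_convex_lower[OF assms(1), of x z] by (simp add: inner_diff_right)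
  qed
  show "ereal (grad f x \<bullet> x - f x) \<le> (SUP z. ereal (grad f x \<bullet> z) - ereal (f z))"
    by (rule SUP_upper2[of x]) auto
qed

text \<open>Tilted by \<open>grad f y\<close>, the function is minimal at \<open>y\<close>, so a
  gradient step from \<open>x\<close> cannot descend below its value at \<open>y\<close>.\<close>

lemma bregman_lower:
  fixes f :: "'a::real_inner \<Rightarrow> real"
  assumes "smooth_strongly_convex \<nu> \<mu> f" "0 \<le> \<mu>" "0 < \<nu>"
  shows "(norm (grad f y - grad f x))\<^sup>2 / (2 * \<nu>) \<le> f x - f y - grad f y \<bullet> (x - y)"
proof -
  obtain z where "f z - grad f y \<bullet> z \<le>
      f x - grad f y \<bullet> x - (norm (grad f y - grad f x))\<^sup>2 / (2 * \<nu>)"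
    using gradient_step_descent[OF assms(1,3), of "grad f y" x] by (auto simp: norm_minus_commute)
  moreover have "0 \<le> \<mu> / 2 * (norm (z - y))\<^sup>2"
    using assms(2) by simp
  ultimately show ?thesis
    using strongly_convex_lower[OF assms(1), of y z] by (simp add: inner_diff_right)
qed

text \<open>Strong convexity is used at \<open>x\<close>; completing the square trades
  \<open>x - y\<close> for the difference of the gradients.\<close>

lemma bregman_upper:
  fixes f :: "'a::real_inner \<Rightarrow> real"
  assumes "smooth_strongly_convex \<nu> \<mu> f" "0 < \<mu>"
  shows "f x - f y - grad f y \<bullet> (x - y) \<le> (norm (grad f y - grad f x))\<^sup>2 / (2 * \<mu>)"
  using strongly_convex_lower[OF assms(1), of x y]
    quadratic_lower_bound[OF assms(2), of "grad f y - grad f x" "x - y"]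
    norm_minus_commute[of x y]
  by (simp add: inner_diff_left inner_diff_right)

text \<open>Writing \<open>v = grad f y\<close> turns the Bregman divergence of the conjugate into
  that of \<open>f\<close> with the two points exchanged.\<close>

lemma conj_bregman_bounds:
  fixes f :: "'a::euclidean_space \<Rightarrow> real"
  assumes ssc: "smooth_strongly_convex \<nu> \<mu> f" and "0 < \<mu>" "0 < \<nu>"
  defines "F \<equiv> \<lambda>u. real_of_ereal (fenchel_conj_real f u)"
  shows "(norm (v - grad f x))\<^sup>2 / (2 * \<nu>) \<le> F v - F (grad f x) - x \<bullet> (v - grad f x)"
    and "F v - F (grad f x) - x \<bullet> (v - grad f x) \<le> (norm (v - grad f x))\<^sup>2 / (2 * \<mu>)"
proof -
  obtain y where v: "v = grad f y"
    using grad_surj[OF ssc assms(2,3)] by metis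
  have "F v - F (grad f x) - x \<bullet> (v - grad f x) = f x - f y - grad f y \<bullet> (x - y)"
    using assms(2) unfolding v F_def
    by (simp add: fenchel_conj_grad[OF ssc] inner_diff_right inner_commute)
  then show "(norm (v - grad f x))\<^sup>2 / (2 * \<nu>) \<le> F v - F (grad f x) - x \<bullet> (v - grad f x)"
    and "F v - F (grad f x) - x \<bullet> (v - grad f x) \<le> (norm (v - grad f x))\<^sup>2 / (2 * \<mu>)"
    using bregman_lower[OF ssc _ assms(3), of y x] bregman_upper[OF ssc assms(2), of x y] assms(2)
    by (simp_all add: v)
qed

text \<open>The first-order remainder of the conjugate with slope \<open>x\<close> lies between 0
  and a quadratic. The result evaluates \<open>f (grad_conj f \<zeta>)\<close> in
  \<open>Delta_term\<close>.\<close>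

lemma grad_conj_grad:
  fixes f :: "'a::euclidean_space \<Rightarrow> real"
  assumes ssc: "smooth_strongly_convex \<nu> \<mu> f" and "0 < \<mu>" "0 < \<nu>"
  shows "grad_conj f (grad f x) = x"
  unfolding grad_conj_def
proof (rule grad_eqI[where C = "1 / (2 * \<mu>)"])
  fix v
  have "0 \<le> (norm (v - grad f x))\<^sup>2 / (2 * \<nu>)"
    using assms(3) by simp
  then show "\<bar>real_of_ereal (fenchel_conj_real f v) - real_of_ereal (fenchel_conj_real f (grad f x))
      - x \<bullet> (v - grad f x)\<bar> \<le> 1 / (2 * \<mu>) * (norm (v - grad f x))\<^sup>2"
    using conj_bregman_bounds[OF assms, where v=v and x=x] by simp
qed

section \<open>The duality gap at the target parameter\<close>

lemma fenchel_conj_not_MInfty: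
  assumes "x \<in> effective_domain g"
  shows "fenchel_conj g u \<noteq> -\<infinity>"
proof -
  have "ereal (u \<bullet> x) - g x \<le> fenchel_conj g u"
    unfolding fenchel_conj_def by (rule SUP_upper) simp
  moreover have "ereal (u \<bullet> x) - g x \<noteq> -\<infinity>"
    using assms by (cases "g x") (auto simp: effective_domain_def)
  ultimately show ?thesis
    by auto
qed

text \<open>For fixed \<open>\<theta>\<close> the gap is affine in the parameter apart from the
  conjugate term. \<open>E_term\<close> equals the gap at \<open>l\<close> with the conjugate
  replaced by its tangent at \<open>\<zeta>\<close>; the error of this replacement is
  \<open>b\<close>.\<close>

lemma duality_gap_decomposition:
  fixes f :: "real ^ 'n \<Rightarrow> real" and X :: "real ^ 'p ^ 'n" and \<Omega> :: "real ^ 'p \<Rightarrow> ereal"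
  assumes ssc: "smooth_strongly_convex \<nu> \<mu> f" and "0 < \<mu>" "0 < \<nu>"
    and "proper_fun \<Omega>" "\<beta> \<in> effective_domain \<Omega>"
    and "fenchel_conj \<Omega> (transpose X *v \<theta>) < \<infinity>"
    and "0 < lt"
  defines "\<zeta> \<equiv> - lt *\<^sub>R \<theta>"
  shows "\<exists>e b. E_term f \<Omega> X l lt \<beta> \<theta> = ereal e \<and> duality_gap f \<Omega> X l \<beta> \<theta> = ereal (e + b) \<and>
    (1 - l / lt)\<^sup>2 * (norm \<zeta>)\<^sup>2 / (2 * \<nu>) \<le> b \<and> b \<le> (1 - l / lt)\<^sup>2 * (norm \<zeta>)\<^sup>2 / (2 * \<mu>)"
proof -
  obtain p where p: "\<Omega> \<beta> = ereal p"
    using assms(4,5) by (cases "\<Omega> \<beta>") (auto simp: proper_fun_def effective_domain_def)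
  obtain q where q: "fenchel_conj \<Omega> (transpose X *v \<theta>) = ereal q"
    using assms(6) fenchel_conj_not_MInfty[OF assms(5)]
    by (cases "fenchel_conj \<Omega> (transpose X *v \<theta>)") auto
  \<comment> \<open>\<open>x\<close> will be the gradient of the conjugate at
    \<open>\<zeta>\<close>; \<open>y\<close> shows that the conjugate is finite at the target dual
    point.\<close>
  obtain x where x: "grad f x = \<zeta>"
    using grad_surj[OF ssc assms(2,3)] by metis
  obtain y where y: "grad f y = - l *\<^sub>R \<theta>"
    using grad_surj[OF ssc assms(2,3)] by metis
  define F where "F u = real_of_ereal (fenchel_conj_real f u)" for u
  have F: "fenchel_conj_real f \<zeta> = ereal (F \<zeta>)"
      "fenchel_conj_real f (- l *\<^sub>R \<theta>) = ereal (F (- l *\<^sub>R \<theta>))"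
    using fenchel_conj_grad[OF ssc, of x] fenchel_conj_grad[OF ssc, of y] assms(2)
    unfolding F_def x y by simp_all
  have F_zeta: "F \<zeta> = \<zeta> \<bullet> x - f x"
    using fenchel_conj_grad[OF ssc, of x] assms(2) unfolding F_def x by simp
  define e where "e = l / lt * (f (X *v \<beta>) + lt * p + F \<zeta> + lt * q)
    + (1 - l / lt) * (f (X *v \<beta>) - f x)"
  define b where "b = F (- l *\<^sub>R \<theta>) - F \<zeta> - x \<bullet> (- l *\<^sub>R \<theta> - \<zeta>)"
  \<comment> \<open>The target dual point is \<open>(l / lt) *\<^sub>R \<zeta>\<close>, a multiple
    of \<open>\<zeta>\<close>.\<close>
  have shift: "- l *\<^sub>R \<theta> - \<zeta> = - (1 - l / lt) *\<^sub>R \<zeta>"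
    using assms(7) unfolding \<zeta>_def by (simp add: algebra_simps)
  have E: "E_term f \<Omega> X l lt \<beta> \<theta> = ereal e"
    using grad_conj_grad[OF assms(1-3), of x] F(1)
    unfolding E_term_def Delta_term_def duality_gap_def p q e_def x \<zeta>_def
    by simp
  have "duality_gap f \<Omega> X l \<beta> \<theta> = ereal (f (X *v \<beta>) + l * p + F (- l *\<^sub>R \<theta>) + l * q)"
    using F(2) unfolding duality_gap_def p q by simp
  also have "f (X *v \<beta>) + l * p + F (- l *\<^sub>R \<theta>) + l * q = e + b"
    using assms(7) unfolding e_def b_def shift F_zeta
    by (simp add: field_simps inner_commute)
  finally have gap: "duality_gap f \<Omega> X l \<beta> \<theta> = ereal (e + b)" .
  have norm: "(norm (- l *\<^sub>R \<theta> - \<zeta>))\<^sup>2 = (1 - l / lt)\<^sup>2 * (norm \<zeta>)\<^sup>2"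
    unfolding shift norm_scaleR by (simp add: power_mult_distrib power2_commute)
  show ?thesis
    using E gap conj_bregman_bounds[OF assms(1-3), of "- l *\<^sub>R \<theta>" x, folded F_def]
    unfolding x norm b_def by blast
qed

section \<open>Bounds on \<open>D_term\<close>\<close>

lemma D_term_less_1:
  assumes "0 < \<mu>" "\<mu> \<le> \<nu>" "0 < r" "r < \<mu> / \<nu>" "0 < l" "l \<le> lt" "lt \<le> \<alpha>" "0 \<le> \<epsilon>"
  shows "D_term \<nu> \<mu> r l lt \<alpha> \<zeta> \<epsilon> < 1"
proof -
  let ?s = "(1 - r * (\<nu> / \<mu>)) * (1 - l / lt)\<^sup>2"
  \<comment> \<open>The prefactor only gives \<open>\<le>\<close>; strictness comes from
    \<open>1 - l / lt < 1\<close>.\<close>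
  have c: "((lt * \<mu>) / (\<alpha> * \<nu>))\<^sup>2 \<le> 1"
    using assms by (intro power_le_one) (auto intro!: mult_mono)
  have rho: "0 \<le> 1 - l / lt" "1 - l / lt < 1"
    using assms by auto
  have "0 \<le> 1 - r * (\<nu> / \<mu>)" "1 - r * (\<nu> / \<mu>) \<le> 1"
    using assms by (simp_all add: field_simps)
  moreover have "(1 - l / lt)\<^sup>2 < 1" "0 \<le> (1 - l / lt)\<^sup>2"
    using rho by (simp_all add: power_less_one_iff abs_square_less_1)
  ultimately have s: "0 \<le> ?s" "?s < 1"
    by (auto intro: le_less_trans[OF mult_left_le_one_le])
  have "0 \<le> 2 * \<nu> * \<epsilon> / (norm \<zeta>)\<^sup>2"
    using assms by simp
  then have "D_term \<nu> \<mu> r l lt \<alpha> \<zeta> \<epsilon> \<le> ((lt * \<mu>) / (\<alpha> * \<nu>))\<^sup>2 * ?s"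
    unfolding D_term_def by (intro mult_left_mono) auto
  also have "\<dots> \<le> ?s"
    using c s by (intro mult_left_le_one_le) auto
  also have "\<dots> < 1"
    by (fact s)
  finally show ?thesis .
qed

text \<open>Here \<open>z\<close> stands for the squared norm of the next \<open>\<zeta>\<close>.
  The prefactor of \<open>D_term\<close> cancels its growth bound up to
  \<open>\<mu> / \<nu>\<close>, which turns \<open>1 / (2 * \<mu>)\<close> into
  \<open>1 / (2 * \<nu>)\<close>; the subtracted term then contributes exactly
  \<open>\<epsilon>\<close>.\<close>

lemma D_term_contraction:
  fixes \<zeta> :: "'a::real_normed_vector"
  assumes mu_nu: "0 < \<mu>" "\<mu> \<le> \<nu>" and pos: "0 \<le> r" "0 < lt" "0 < \<alpha>" and "\<zeta> \<noteq> 0"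
    and D: "0 \<le> D_term \<nu> \<mu> r l lt \<alpha> \<zeta> \<epsilon>"
    and z: "z \<le> \<nu> / \<mu> * (\<alpha> / lt)\<^sup>2 * (norm \<zeta>)\<^sup>2"
  shows "D_term \<nu> \<mu> r l lt \<alpha> \<zeta> \<epsilon> * z / (2 * \<mu>) + \<epsilon>
    \<le> (1 - r) * ((1 - l / lt)\<^sup>2 * (norm \<zeta>)\<^sup>2 / (2 * \<nu>))"
proof -
  let ?D = "D_term \<nu> \<mu> r l lt \<alpha> \<zeta> \<epsilon>" and ?\<rho> = "(1 - l / lt)\<^sup>2" and ?n = "(norm \<zeta>)\<^sup>2"
  have n: "0 < ?n"
    using assms by simp
  have "?D * z \<le> ?D * (\<nu> / \<mu> * (\<alpha> / lt)\<^sup>2 * ?n)"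
    using D z by (rule mult_left_mono[rotated])
  also have "\<dots> = \<mu> / \<nu> * (((1 - r * (\<nu> / \<mu>)) * ?\<rho> - 2 * \<nu> * \<epsilon> / ?n) * ?n)"
    unfolding D_term_def using mu_nu pos by (simp add: power2_eq_square)
  also have "((1 - r * (\<nu> / \<mu>)) * ?\<rho> - 2 * \<nu> * \<epsilon> / ?n) * ?n = (1 - r * (\<nu> / \<mu>)) * (?\<rho> * ?n) - 2 * \<nu> * \<epsilon>"
    using n by (simp add: left_diff_distrib)
  finally have "?D * z / (2 * \<mu>) \<le>
      \<mu> / \<nu> * ((1 - r * (\<nu> / \<mu>)) * (?\<rho> * ?n) - 2 * \<nu> * \<epsilon>) / (2 * \<mu>)"
    using mu_nu by (intro divide_right_mono) auto
  also have "\<dots> = (1 - r * (\<nu> / \<mu>)) * (?\<rho> * ?n / (2 * \<nu>)) - \<epsilon>"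
    using mu_nu by (simp add: field_simps)
  also have "\<dots> \<le> (1 - r) * (?\<rho> * ?n / (2 * \<nu>)) - \<epsilon>"
  proof -
    have "r * 1 \<le> r * (\<nu> / \<mu>)"
      using mu_nu pos by (intro mult_left_mono) auto
    then show ?thesis
      using mu_nu by (intro diff_right_mono mult_right_mono) auto
  qed
  finally show ?thesis
    by simp
qed

section \<open>Contraction of the duality gap along the iterates\<close>

theorem proposition1:
  fixes f :: "real ^ 'n \<Rightarrow> real"
    and X :: "real ^ 'p ^ 'n"
    and \<Omega> :: "real ^ 'p \<Rightarrow> ereal"
    and \<mu> \<nu> l r :: real
    and T :: nat
    and lam \<alpha> \<epsilon> :: "nat \<Rightarrow> real"
    and \<beta> :: "nat \<Rightarrow> real ^ 'p"
    and \<theta> \<zeta> :: "nat \<Rightarrow> real ^ 'n"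
  assumes mu_nu: "0 < \<mu>" "\<mu> \<le> \<nu>"
    and f: "smooth_strongly_convex \<nu> \<mu> f"
    and inf_f: "(INF z. ereal (f z)) = 0"
    and Omega: "proper_fun \<Omega>" "closed_fun \<Omega>" "convex_fun \<Omega>"
    and target: "0 < l" "l < lam 0"
    and T: "1 \<le> T"
    and r: "0 < r" "r < \<mu> / \<nu>"
    and beta: "\<And>t. t \<le> T \<Longrightarrow> \<beta> t \<in> effective_domain \<Omega>"
    and alpha: "\<And>t. t \<le> T \<Longrightarrow> lam t \<le> \<alpha> t"
    and theta: "\<And>t. t \<le> T \<Longrightarrow> \<theta> t = - (1 / \<alpha> t) *\<^sub>R grad f (X *v \<beta> t)"
    and dual_feasible: "\<And>t. t \<le> T \<Longrightarrow> fenchel_conj \<Omega> (transpose X *v \<theta> t) < \<infinity>"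
    and zeta: "\<And>t. t \<le> T \<Longrightarrow> \<zeta> t = - lam t *\<^sub>R \<theta> t"
    and eps: "\<And>t. t < T \<Longrightarrow> 0 \<le> \<epsilon> t"
    and zeta_nonzero: "\<And>t. t < T \<Longrightarrow> \<zeta> t \<noteq> 0"
    and descent: "\<And>t. t < T \<Longrightarrow> f (X *v \<beta> (Suc t)) \<le> f (X *v \<beta> t)"
    and D_nonneg: "\<And>t. t < T \<Longrightarrow> 0 \<le> D_term \<nu> \<mu> r l (lam t) (\<alpha> t) (\<zeta> t) (\<epsilon> t)"
    and lam_step: "\<And>t. t < T \<Longrightarrow>
          lam (Suc t) = l / (1 - sqrt (D_term \<nu> \<mu> r l (lam t) (\<alpha> t) (\<zeta> t) (\<epsilon> t)))"
    and E_step: "\<And>t. t < T \<Longrightarrow>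
          E_term f \<Omega> X l (lam (Suc t)) (\<beta> (Suc t)) (\<theta> (Suc t))
            \<le> ereal (1 - r) * E_term f \<Omega> X l (lam t) (\<beta> t) (\<theta> t) + ereal (\<epsilon> t)"
  shows "duality_gap f \<Omega> X l (\<beta> T) (\<theta> T)
           \<le> ereal ((1 - r) ^ T) * duality_gap f \<Omega> X l (\<beta> 0) (\<theta> 0)"
proof -
  let ?D = "\<lambda>t. D_term \<nu> \<mu> r l (lam t) (\<alpha> t) (\<zeta> t) (\<epsilon> t)"
  have nu: "0 < \<nu>"
    using mu_nu by simp
  \<comment> \<open>The bound \<open>?D t < 1\<close> relies on \<open>l \<le> lam t\<close> and
    keeps the next denominator in \<open>(0, 1]\<close>, hence the induction. Only
    \<open>\<le>\<close> persists, as \<open>?D t = 0\<close> gives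
    \<open>lam (Suc t) = l\<close>.\<close>
  have lam: "l \<le> lam t" if "t \<le> T" for t
    using that
  proof (induction t)
    case 0
    then show ?case
      using target by simp
  next
    case (Suc t)
    then have "?D t < 1"
      using mu_nu r target alpha eps by (intro D_term_less_1) auto
    then have "0 < 1 - sqrt (?D t)" "1 - sqrt (?D t) \<le> 1"
      using D_nonneg[of t] Suc.prems by auto
    then show ?case
      using lam_step[of t] Suc.prems target by (simp add: le_divide_eq mult_left_le)
  qed
  have lam_pos: "0 < lam t" "0 < \<alpha> t" if "t \<le> T" for t
    using lam[OF that] alpha[OF that] target by auto
  have f_nonneg: "0 \<le> f z" for z
  proof -
    have "(INF z. ereal (f z)) \<le> ereal (f z)"
      by (rule INF_lower) simp
    then show ?thesis
      by (simp add: inf_f)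
  qed
  have norm_zeta: "(norm (\<zeta> t))\<^sup>2 = (lam t / \<alpha> t)\<^sup>2 * (norm (grad f (X *v \<beta> t)))\<^sup>2" if "t \<le> T" for t
    using zeta[OF that] theta[OF that] lam_pos[OF that]
    by (simp add: power_mult_distrib power_divide)
  \<comment> \<open>Descent of \<open>f\<close> carries over to squared gradient norms up to the
    condition number \<open>\<nu> / \<mu>\<close>; \<open>(\<alpha> t / lam t)\<^sup>2\<close>
    converts back to \<open>\<zeta> t\<close>.\<close>
  have zeta_growth: "(norm (\<zeta> (Suc t)))\<^sup>2 \<le> \<nu> / \<mu> * (\<alpha> t / lam t)\<^sup>2 * (norm (\<zeta> t))\<^sup>2" if "t < T" for t
  proof -
    let ?g = "\<lambda>t. (norm (grad f (X *v \<beta> t)))\<^sup>2"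
    have t: "t \<le> T" "Suc t \<le> T"
      using that by auto
    have "(lam (Suc t) / \<alpha> (Suc t))\<^sup>2 \<le> 1"
      using lam_pos[OF t(2)] alpha[OF t(2)] by (intro power_le_one) auto
    then have "(norm (\<zeta> (Suc t)))\<^sup>2 \<le> ?g (Suc t)"
      unfolding norm_zeta[OF t(2)] by (intro mult_left_le_one_le) auto
    also have "\<dots> \<le> 2 * \<nu> * f (X *v \<beta> (Suc t))"
      by (rule norm_grad_le[OF f nu f_nonneg])
    also have "\<dots> \<le> 2 * \<nu> * f (X *v \<beta> t)"
      using descent[OF that] nu by simp
    also have "\<dots> = \<nu> / \<mu> * (2 * \<mu> * f (X *v \<beta> t))"
      using mu_nu by simp
    also have "\<dots> \<le> \<nu> / \<mu> * ?g t"
      using Polyak_Lojasiewicz[OF f mu_nu(1) inf_f] mu_nu by (intro mult_left_mono) auto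
    also have "\<dots> = \<nu> / \<mu> * (\<alpha> t / lam t)\<^sup>2 * (norm (\<zeta> t))\<^sup>2"
      unfolding norm_zeta[OF t(1)] using lam_pos[OF t(1)] by (simp add: power2_eq_square)
    finally show ?thesis .
  qed
  have "\<exists>e b. E_term f \<Omega> X l (lam t) (\<beta> t) (\<theta> t) = ereal e \<and>
      duality_gap f \<Omega> X l (\<beta> t) (\<theta> t) = ereal (e + b) \<and>
      (1 - l / lam t)\<^sup>2 * (norm (\<zeta> t))\<^sup>2 / (2 * \<nu>) \<le> b \<and>
      b \<le> (1 - l / lam t)\<^sup>2 * (norm (\<zeta> t))\<^sup>2 / (2 * \<mu>)" if "t \<le> T" for t
    using duality_gap_decomposition[OF f mu_nu(1) nu Omega(1) beta dual_feasible lam_pos(1)] that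
    by (simp add: zeta)
  then obtain e b where e: "\<And>t. t \<le> T \<Longrightarrow> E_term f \<Omega> X l (lam t) (\<beta> t) (\<theta> t) = ereal (e t)"
    and gap: "\<And>t. t \<le> T \<Longrightarrow> duality_gap f \<Omega> X l (\<beta> t) (\<theta> t) = ereal (e t + b t)"
    and b_lower: "\<And>t. t \<le> T \<Longrightarrow> (1 - l / lam t)\<^sup>2 * (norm (\<zeta> t))\<^sup>2 / (2 * \<nu>) \<le> b t"
    and b_upper: "\<And>t. t \<le> T \<Longrightarrow> b t \<le> (1 - l / lam t)\<^sup>2 * (norm (\<zeta> t))\<^sup>2 / (2 * \<mu>)"
    by metis
  have r1: "0 \<le> 1 - r"
  proof -
    have "\<mu> / \<nu> \<le> 1"
      using mu_nu by simp
    then show ?thesis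
      using r by linarith
  qed
  have step: "e (Suc t) + b (Suc t) \<le> (1 - r) * (e t + b t)" if "t < T" for t
  proof -
    have t: "t \<le> T" "Suc t \<le> T"
      using that by auto
    \<comment> \<open>The step size rule is this equation solved for \<open>lam (Suc t)\<close>; it
      puts \<open>?D t\<close> into the upper bound on \<open>b (Suc t)\<close>.\<close>
    have "1 - l / lam (Suc t) = sqrt (?D t)"
      using lam_step[OF that] target lam_pos(1)[OF t(2)] by auto
    then have "(1 - l / lam (Suc t))\<^sup>2 = ?D t"
      using D_nonneg[OF that] by simp
    then have "b (Suc t) + \<epsilon> t \<le> ?D t * (norm (\<zeta> (Suc t)))\<^sup>2 / (2 * \<mu>) + \<epsilon> t"
      using b_upper[OF t(2)] by simp
    also have "\<dots> \<le> (1 - r) * ((1 - l / lam t)\<^sup>2 * (norm (\<zeta> t))\<^sup>2 / (2 * \<nu>))"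
      using r by (intro D_term_contraction mu_nu lam_pos t zeta_nonzero D_nonneg zeta_growth that) auto
    also have "\<dots> \<le> (1 - r) * b t"
      using b_lower[OF t(1)] r1 by (rule mult_left_mono)
    finally have "b (Suc t) + \<epsilon> t \<le> (1 - r) * b t" .
    \<comment> \<open>The error \<open>\<epsilon> t\<close> incurred by \<open>e\<close> is the
      slack left in the contraction of \<open>b\<close>, so it cancels in the sum.\<close>
    moreover have "e (Suc t) \<le> (1 - r) * e t + \<epsilon> t"
      using E_step[OF that] e[OF t(1)] e[OF t(2)] by simp
    ultimately show ?thesis
      by (simp add: distrib_left)
  qed
  have "e t + b t \<le> (1 - r) ^ t * (e 0 + b 0)" if "t \<le> T" for t
    using that
  proof (induction t)
    case 0
    then show ?case
      by simp
  next
    case (Suc t)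
    have "e (Suc t) + b (Suc t) \<le> (1 - r) * (e t + b t)"
      using step Suc.prems by simp
    also have "\<dots> \<le> (1 - r) * ((1 - r) ^ t * (e 0 + b 0))"
      using Suc r1 by (intro mult_left_mono) auto
    finally show ?case
      by (simp add: mult.assoc)
  qed
  then show ?thesis
    by (simp add: gap)
qed

end
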